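(* Let $(a_n)_{n\ge1}$ be defined by $a_1=1$ and $a_n=a_{n-1}+\operatorname{lcm}(n,a_{n-1})$ for $n\ge2$, and for $n\ge2$ let $b_n=\frac{n}{\gcd(n,a_{n-1})}$. For a prime $p$ and $m\ge1$ let $S^{(1)}_p(m)=\#\{q\le m:\ q\in\mathbb{P},\ q\ne 3,\ q\equiv -1 \pmod p\}$, for $n\ge 2$ let $\delta^{(1)}_p(n)=\max\{0,\ v_p(n)-S^{(1)}_p(n-1)\}$, and let $B^{(1)}_n=\prod_p p^{\delta^{(1)}_p(n)}$. If $n\ge2$ satisfies $\sum_p\delta^{(1)}_p(n)\le 1$, then $B^{(1)}_n\in\{1\}\cup\mathbb{P}$, and consequently $b_n\in\{1\}\cup\mathbb{P}$.
   Context: $\mathbb{P}$ denotes the set of primes and $v_p(n)$ the $p$-adic valuation of $n$. Sums and products over $p$ range over all primes. *)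

theory Defs
  imports "HOL-Number_Theory.Cong" "HOL-Library.Groups_Big_Fun"
begin

(* The sequence is indexed from 1; the value at 0 is a dummy that no other value depends on. *)
fun lcm_seq :: "nat \<Rightarrow> nat" where
  "lcm_seq 0 = 0"
| "lcm_seq (Suc 0) = 1"
| "lcm_seq (Suc (Suc k)) = lcm_seq (Suc k) + lcm (Suc (Suc k)) (lcm_seq (Suc k))"

lemma lcm_seq_one: "lcm_seq 1 = 1"
  by simp

lemma lcm_seq_rec:
  assumes "n \<ge> 2"
  shows "lcm_seq n = lcm_seq (n - 1) + lcm n (lcm_seq (n - 1))"
proof -
  obtain k where "n = Suc (Suc k)"
    using assms by (metis add_2_eq_Suc le_Suc_ex)
  then show ?thesis by simp
qed

(* The division is exact; used for n >= 2 only. *)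
definition b_seq :: "nat \<Rightarrow> nat" where
  "b_seq n = n div gcd n (lcm_seq (n - 1))"

definition S1 :: "nat \<Rightarrow> nat \<Rightarrow> nat" where
  "S1 p m = card {q. q \<le> m \<and> prime q \<and> q \<noteq> 3 \<and> [int q = - 1] (mod int p)}"

(* Truncated subtraction on nat is max {0, _}. *)
definition delta1 :: "nat \<Rightarrow> nat \<Rightarrow> nat" where
  "delta1 p n = multiplicity p n - S1 p (n - 1)"

(* Sums and products over all primes: Sum_any and Prod_any range over the whole type and
   are the honest sum and product as soon as only finitely many terms are nontrivial,
   which finite_delta1_support below guarantees. A plain sum or prod over the infinite
   set of primes would collapse to 0 or 1. *)
definition sum_delta1 :: "nat \<Rightarrow> nat" where
  "sum_delta1 n = Sum_any (\<lambda>p. if prime p then delta1 p n else 0)"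

definition B1 :: "nat \<Rightarrow> nat" where
  "B1 n = Prod_any (\<lambda>p. if prime p then p ^ delta1 p n else 1)"

lemma finite_delta1_support:
  assumes "n > 0"
  shows "finite {p. (if prime p then delta1 p n else 0) \<noteq> 0}"
    and "finite {p. (if prime p then p ^ delta1 p n else 1) \<noteq> 1}"
proof -
  have sub: "p \<le> n" if "delta1 p n \<noteq> 0" for p
  proof -
    have "multiplicity p n \<noteq> 0"
      using that by (auto simp: delta1_def)
    then have "p dvd n"
      by (metis not_dvd_imp_multiplicity_0)
    then show ?thesis
      using assms by (rule dvd_imp_le)
  qed
  show "finite {p. (if prime p then delta1 p n else 0) \<noteq> 0}"
    by (rule finite_subset[of _ "{..n}"]) (auto split: if_splits intro: sub)
  show "finite {p. (if prime p then p ^ delta1 p n else 1) \<noteq> 1}"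
  proof (rule finite_subset[of _ "{..n}"])
    show "{p. (if prime p then p ^ delta1 p n else 1) \<noteq> 1} \<subseteq> {..n}"
    proof
      fix p assume "p \<in> {p. (if prime p then p ^ delta1 p n else 1) \<noteq> 1}"
      then have "delta1 p n \<noteq> 0"
        by (cases "delta1 p n = 0") (auto split: if_splits)
      then show "p \<in> {..n}" using sub by simp
    qed
  qed simp
qed

end

theory Submission
  imports Defs
begin

text \<open>
  Since \<open>a\<^sub>n = a\<^sub>n\<^sub>-\<^sub>1 (1 + b\<^sub>n)\<close>, a prime \<open>q \<noteq> 3\<close> does not divide \<open>a\<^sub>q\<^sub>-\<^sub>1\<close>: the factors \<open>1 + b\<^sub>k\<close> with
  \<open>k < q\<close> are at most \<open>q\<close>, with equality only if \<open>b\<^sub>q\<^sub>-\<^sub>1 = q - 1\<close>, which fails because \<open>q - 1\<close> and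
  \<open>a\<^sub>q\<^sub>-\<^sub>2\<close> are both even for \<open>q \<ge> 5\<close>. So \<open>b\<^sub>q = q\<close>, and every such \<open>q\<close> congruent to \<open>-1\<close> modulo
  \<open>p\<close> contributes a factor \<open>q + 1\<close> divisible by \<open>p\<close>. Therefore \<open>v\<^sub>p(a\<^sub>n\<^sub>-\<^sub>1)\<close> is at least
  \<open>S\<^sub>p(n - 1)\<close>, so that \<open>b\<^sub>n\<close> divides \<open>B\<^sub>n\<close>.
\<close>

lemma lcm_seq_mult_b_seq:
  assumes "n \<ge> 2"
  shows "lcm_seq n = lcm_seq (n - 1) * (1 + b_seq n)"
  by (simp add: lcm_seq_rec[OF assms] b_seq_def lcm_nat_def div_mult_swap mult.commute[of n] distrib_left)

lemma lcm_seq_pos: "n \<ge> 1 \<Longrightarrow> lcm_seq n > 0"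
proof (induction n rule: nat_induct_at_least)
  case (Suc n)
  then show ?case
    using lcm_seq_mult_b_seq[of "Suc n"] by simp
qed simp

lemma b_seq_le: "b_seq n \<le> n"
  by (simp add: b_seq_def)

text \<open>Each term divides the next, so parity is settled by \<open>lcm_seq 3 = 6\<close>; the
  terms before it, 1 and 3, are odd.\<close>

lemma even_lcm_seq: "n \<ge> 3 \<Longrightarrow> even (lcm_seq n)"
proof (induction n rule: nat_induct_at_least)
  case base
  then show ?case by (simp add: numeral_3_eq_3 lcm_nat_def)
next
  case (Suc n)
  then show ?case
    using lcm_seq_mult_b_seq[of "Suc n"] by simp
qed

lemma b_seq_less_if_even:
  assumes "n \<ge> 4" "even n"
  shows "b_seq n < n"
proof -
  have "2 dvd gcd n (lcm_seq (n - 1))"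
    using assms even_lcm_seq[of "n - 1"] by simp
  then have "gcd n (lcm_seq (n - 1)) \<ge> 2"
    using assms by (intro dvd_imp_le) auto
  then show ?thesis
    using assms by (auto simp: b_seq_def intro!: div_less_dividend)
qed

text \<open>The prime 3 is a genuine exception, since \<open>lcm_seq 2 = 3\<close>.\<close>

lemma prime_not_dvd_lcm_seq:
  assumes "prime q" "q \<noteq> 3" "1 \<le> k" "k < q"
  shows "\<not> q dvd lcm_seq k"
  using assms(3,4)
proof (induction k rule: nat_induct_at_least)
  case base
  then show ?case using assms(1) by auto
next
  case (Suc k)
  have rec: "lcm_seq (Suc k) = lcm_seq k * (1 + b_seq (Suc k))"
    using lcm_seq_mult_b_seq[of "Suc k"] Suc.hyps by simp
  have "1 + b_seq (Suc k) < q"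
  proof (cases "Suc k = q - 1")
    case True
    \<comment> \<open>Here \<open>q\<close> is at least 3; with 3 and 4 excluded,
      \<open>q - 1\<close> is even and at least 4, as \<open>b_seq_less_if_even\<close>
      requires.\<close>
    have "q \<noteq> 4"
      using assms(1) by (auto simp: prime_nat_iff dest!: spec[of _ "2::nat"])
    then have "q \<ge> 5"
      using True Suc.hyps assms(2) by linarith
    then have "odd q"
      using prime_odd_nat[OF assms(1)] by simp
    then have "b_seq (Suc k) < Suc k"
      using True \<open>q \<ge> 5\<close> by (intro b_seq_less_if_even) auto
    then show ?thesis using True by linarith
  next
    case False
    then show ?thesis using Suc.prems b_seq_le[of "Suc k"] by linarith
  qed
  then have "\<not> q dvd 1 + b_seq (Suc k)"
    by (auto dest: dvd_imp_le)
  then show ?case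
    unfolding rec using Suc assms(1) by (subst prime_dvd_mult_iff) auto
qed

lemma b_seq_prime:
  assumes "prime q" "q \<noteq> 3"
  shows "b_seq q = q"
proof -
  have "q \<ge> 2" using assms(1) by (rule prime_ge_2_nat)
  then have "\<not> q dvd lcm_seq (q - 1)"
    using assms by (intro prime_not_dvd_lcm_seq) auto
  then have "gcd q (lcm_seq (q - 1)) = 1"
    using assms(1) prime_imp_coprime by (metis coprime_iff_gcd_eq_1)
  then show ?thesis by (simp add: b_seq_def)
qed

lemma S1_Suc:
  "S1 p (Suc m) =
    S1 p m + (if prime (Suc m) \<and> Suc m \<noteq> 3 \<and> [int (Suc m) = - 1] (mod int p) then 1 else 0)"
proof -
  let ?P = "\<lambda>q. prime q \<and> q \<noteq> 3 \<and> [int q = - 1] (mod int p)"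
  have "{q. q \<le> Suc m \<and> ?P q} =
      (if ?P (Suc m) then insert (Suc m) {q. q \<le> m \<and> ?P q} else {q. q \<le> m \<and> ?P q})"
    by (auto simp: le_Suc_eq)
  then show ?thesis by (simp add: S1_def)
qed

lemma S1_le_multiplicity_lcm_seq:
  assumes "prime p" "m \<ge> 1"
  shows "S1 p m \<le> multiplicity p (lcm_seq m)"
  using assms(2)
proof (induction m rule: nat_induct_at_least)
  case base
  have "{q. q \<le> 1 \<and> prime q \<and> q \<noteq> 3 \<and> [int q = - 1] (mod int p)} = {}"
    by (auto dest: prime_gt_1_nat)
  then show ?case by (simp add: S1_def)
next
  case (Suc m)
  \<comment> \<open>Valuations add along the product, so each prime counted by \<open>S1\<close>
    contributes through its own factor.\<close>
  have "multiplicity p (lcm_seq (Suc m)) =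
      multiplicity p (lcm_seq m) + multiplicity p (1 + b_seq (Suc m))"
    using prime_elem_multiplicity_mult_distrib[of p "lcm_seq m" "1 + b_seq (Suc m)"]
      lcm_seq_mult_b_seq[of "Suc m"] lcm_seq_pos[of m] Suc.hyps assms(1)
    by simp
  moreover have "multiplicity p (1 + b_seq (Suc m)) \<ge> 1"
    if "prime (Suc m)" "Suc m \<noteq> 3" "[int (Suc m) = - 1] (mod int p)"
  proof -
    have "int p dvd int (Suc m + 1)"
      using that(3) by (simp add: cong_iff_dvd_diff)
    then have "p dvd 1 + b_seq (Suc m)"
      using b_seq_prime[OF that(1,2)] by (simp only: int_dvd_int_iff add.commute)
    then have "multiplicity p (1 + b_seq (Suc m)) > 0"
      using assms(1) prime_gt_1_nat by (subst multiplicity_gt_zero_iff) auto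
    then show ?thesis by simp
  qed
  ultimately show ?case using Suc.IH by (auto simp: S1_Suc)
qed

text \<open>Dividing by the gcd leaves the truncated difference of the valuations of
  \<open>n\<close> and \<open>lcm_seq (n - 1)\<close>; a lower bound on the latter bounds it from
  above.\<close>

lemma multiplicity_b_seq_le_delta1:
  assumes "prime p" "n \<ge> 2"
  shows "multiplicity p (b_seq n) \<le> delta1 p n"
proof -
  let ?g = "gcd n (lcm_seq (n - 1))"
  have "lcm_seq (n - 1) \<noteq> 0"
    using lcm_seq_pos[of "n - 1"] assms(2) by simp
  then have g: "multiplicity p ?g = min (multiplicity p n) (multiplicity p (lcm_seq (n - 1)))"
    using assms by (intro multiplicity_gcd) auto
  have n: "b_seq n * ?g = n"
    by (simp add: b_seq_def)
  then have "b_seq n \<noteq> 0" "?g \<noteq> 0"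
    using assms(2) by (metis mult_0 not_numeral_le_zero, simp)
  then have "multiplicity p (b_seq n * ?g) = multiplicity p (b_seq n) + multiplicity p ?g"
    using assms(1) by (intro prime_elem_multiplicity_mult_distrib) auto
  then show ?thesis
    using S1_le_multiplicity_lcm_seq[OF assms(1), of "n - 1"] assms(2) g
    unfolding n delta1_def by linarith
qed

lemma multiplicity_B1:
  assumes "prime p" "n > 0"
  shows "multiplicity p (B1 n) = delta1 p n"
proof -
  let ?A = "{q. (if prime q then q ^ delta1 q n else 1) \<noteq> 1}"
  have fin: "finite ?A" using finite_delta1_support(2)[OF assms(2)] .
  have A: "prime q" if "q \<in> ?A" for q
    using that by (auto split: if_splits)
  have "B1 n = (\<Prod>q\<in>?A. q ^ delta1 q n)"
    unfolding B1_def Prod_any.expand_set by (rule prod.cong) (auto split: if_splits)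
  also have "multiplicity p \<dots> = (if p \<in> ?A then delta1 p n else 0)"
    using fin A assms(1) by (rule multiplicity_prod_prime_powers)
  \<comment> \<open>Outside the support \<open>p ^ delta1 p n = 1\<close>, which forces exponent 0
    because \<open>p > 1\<close>.\<close>
  also have "\<dots> = delta1 p n"
    using assms(1) prime_gt_1_nat[OF assms(1)] by auto
  finally show ?thesis .
qed

lemma b_seq_dvd_B1:
  assumes "n \<ge> 2"
  shows "b_seq n dvd B1 n"
proof (rule multiplicity_le_imp_dvd)
  show "b_seq n \<noteq> 0"
    using assms by (simp add: b_seq_def div_eq_0_iff not_less)
  show "multiplicity p (b_seq n) \<le> multiplicity p (B1 n)" if "prime p" for p
    using multiplicity_b_seq_le_delta1[OF that assms] multiplicity_B1[OF that] assms by simp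
qed

text \<open>A sum of natural numbers that is at most 1 has at most one nonzero term, and that term
  is 1. So the product is empty or a single prime to the first power.\<close>

lemma B1_cases:
  assumes "n > 0" "sum_delta1 n \<le> 1"
  shows "B1 n = 1 \<or> prime (B1 n)"
proof (cases "\<exists>p. prime p \<and> delta1 p n \<noteq> 0")
  case False
  then have "(\<lambda>p. if prime p then p ^ delta1 p n else 1) = (\<lambda>_. 1)"
    by auto
  then have "B1 n = 1"
    unfolding B1_def by (simp only: Prod_any.neutral)
  then show ?thesis ..
next
  case True
  then obtain p where p: "prime p" "delta1 p n \<noteq> 0" by blast
  let ?f = "\<lambda>q. if prime q then delta1 q n else 0"
  have fin: "finite {q. ?f q \<noteq> 0}"
    using finite_delta1_support(1)[OF assms(1)] .
  have sum_le: "sum ?f {q. ?f q \<noteq> 0} \<le> 1"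
    using assms(2) by (simp only: sum_delta1_def Sum_any.expand_set)
  have "?f p \<le> sum ?f {q. ?f q \<noteq> 0}"
    using fin p by (intro member_le_sum) auto
  then have one: "delta1 p n = 1"
    using sum_le p by simp
  have other: "delta1 q n = 0" if "prime q" "q \<noteq> p" for q
  proof (rule ccontr)
    assume "delta1 q n \<noteq> 0"
    \<comment> \<open>A second prime in the support would push the sum to at least 2.\<close>
    then have "sum ?f {p, q} \<le> sum ?f {q. ?f q \<noteq> 0}"
      using fin p that by (intro sum_mono2) auto
    then have "delta1 p n + delta1 q n \<le> 1"
      using sum_le p that by simp
    then show False
      using one \<open>delta1 q n \<noteq> 0\<close> by simp
  qed
  have "(\<lambda>q. if prime q then q ^ delta1 q n else 1) = (\<lambda>q. if q = p then p else 1)"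
    using p(1) one other by auto
  then have "B1 n = p"
    unfolding B1_def by (simp only: Prod_any.delta)
  then show ?thesis using p(1) by simp
qed

theorem theorem4p9:
  fixes n :: nat
  assumes "n \<ge> 2"
    and "sum_delta1 n \<le> 1"
  shows "B1 n \<in> {1} \<union> {p. prime p} \<and> b_seq n \<in> {1} \<union> {p. prime p}"
proof -
  have "B1 n = 1 \<or> prime (B1 n)"
    using assms by (intro B1_cases) auto
  \<comment> \<open>A divisor of 1 or of a prime is 1 or the number itself.\<close>
  moreover have "b_seq n = 1 \<or> b_seq n = B1 n"
    using calculation b_seq_dvd_B1[OF assms(1)] by (auto simp: prime_nat_iff)
  ultimately show ?thesis by auto
qed

end
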